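(* For every integer $n\ge 1$ and every $t\in[n]$, the coin $t$ can be identified among the coins $[n]$ in at most seven weighings.
   Context: Write $[n]=\{1,2,\ldots,n\}$. There are $n$ coins labelled $1,\ldots,n$. It is known to the audience that the coins weigh $1,2,\ldots,n$ grams in some order, i.e. that there is a permutation $w$ of $[n]$ such that the coin labelled $i$ weighs $w(i)$ grams, but the audience does not know $w$. In truth $w$ is the identity (the coin labelled $i$ weighs $i$ grams), and the person conducting the weighings knows this. A weighing is a pair $(A,B)$ of disjoint subsets of $[n]$ (coins on the left and right pans of a balance scale; the remaining coins are left out). Its outcome for a permutation $w$ is whether $\sum_{i\in A} w(i)$ is less than, equal to, or greater than $\sum_{i\in B} w(i)$. A list of weighings identifies the coin $t\in[n]$ if every permutation $w$ of $[n]$ that gives the same outcome as the identity permutation for every weighing in the list satisfies $w(t)=t$. The list of weighings may depend on $n$ and $t$. *)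

theory Defs
  imports "HOL-Combinatorics.Permutations"
begin

type_synonym weighing = "nat set \<times> nat set"

definition is_weighing :: "nat \<Rightarrow> weighing \<Rightarrow> bool" where
  "is_weighing n W \<longleftrightarrow> fst W \<subseteq> {1..n} \<and> snd W \<subseteq> {1..n} \<and> fst W \<inter> snd W = {}"

datatype outcome = Less | Equal | Greater

definition outcome_of :: "(nat \<Rightarrow> nat) \<Rightarrow> weighing \<Rightarrow> outcome" where
  "outcome_of w W =
     (let l = (\<Sum>i\<in>fst W. w i); r = (\<Sum>i\<in>snd W. w i)
      in if l < r then Less else if l = r then Equal else Greater)"

text \<open>The true weight assignment is the identity: coin \<open>i\<close> weighs \<open>i\<close> grams.\<close>

definition identifies :: "nat \<Rightarrow> weighing list \<Rightarrow> nat \<Rightarrow> bool" where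
  "identifies n Ws t \<longleftrightarrow>
     (\<forall>w. w permutes {1..n} \<longrightarrow>
        (\<forall>W\<in>set Ws. outcome_of w W = outcome_of id W) \<longrightarrow> w t = t)"

end

theory Submission
  imports Defs "HOL-Computational_Algebra.Primes"
begin

text \<open>
  Fix a weight assignment \<open>w\<close> that agrees with every outcome, and write \<open>s X\<close> for the sum of \<open>w\<close> over
  \<open>X\<close>. Weighing \<open>X - Y\<close> against \<open>Y - X\<close> compares \<open>s X\<close> with \<open>s Y\<close>; if \<open>X\<close> and \<open>Y\<close> truly weigh the
  same, it yields \<open>s X = s Y\<close>. On the other hand \<open>s {1..b} \<ge> 1 + \<dots> + b = tri b\<close> for every \<open>b\<close>, because the
  weights are distinct positive integers. So if the outcomes bound a sum of several \<open>s {1..b}\<close> from above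
  by the sum of the numbers \<open>tri b\<close>, then each of these bounds is attained. If \<open>t - 1\<close> and \<open>t\<close> are among
  the \<open>b\<close>, then \<open>w t = tri t - tri (t - 1) = t\<close>.
  
  Such an upper bound comes from the fact that all coins together weigh \<open>tri n\<close>. As
  \<open>tri (t - 1) + tri t = t\<^sup>2\<close>, the number \<open>tri n - t\<^sup>2\<close> (or \<open>2 * tri n - t\<^sup>2\<close>, if \<open>t\<^sup>2\<close> exceeds \<open>tri n\<close>) has
  to be written as a sum of triangular numbers, and four of them suffice by a consequence of Lagrange's
  theorem on four squares. This gives six prefixes \<open>{1..b}\<close>, grouped in three pairs.
  
  The prefixes overlap, so that they cannot be compared with disjoint parts of \<open>{1..n}\<close> at once. Each
  pair is therefore first traded for one set \<open>A\<close> of the same total weight. For prefixes \<open>u \<le> v\<close> one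
  weighing of \<open>{1..v}\<close> against some \<open>D \<subseteq> {u<..n}\<close> does this, with \<open>A = {1..u} \<union> D\<close>. Such a \<open>D\<close> exists if
  the pair accounts for at most half of \<open>tri n\<close>, apart from a few equal pairs that a suitable choice of the
  triangular numbers avoids (\<open>tri_subset_sum_above\<close>). A heavier pair takes two weighings
  (\<open>merges_two_weighings\<close>). If \<open>t\<^sup>2 > tri n\<close>, then the pair \<open>t - 1, t\<close> takes one weighing, which uses up all
  of \<open>{1..n}\<close> once (\<open>merges_overflow\<close>). At most one pair needs two weighings, so that four weighings are
  enough. The three resulting sets are then weighed against the three parts of a partition of \<open>{1..n}\<close> with
  matching sums (\<open>partition_three_sums\<close>), which makes seven. For \<open>n \<le> 8\<close> it is enough to weigh each coin
  against the next one.
\<close>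

section \<open>Sums of four squares\<close>

definition four_squares :: "int \<Rightarrow> bool" where
  "four_squares k \<longleftrightarrow> (\<exists>a b c d. k = a\<^sup>2 + b\<^sup>2 + c\<^sup>2 + d\<^sup>2)"

lemma euler_four_square_identity:
  fixes a b c d p q r s :: int
  shows "(a\<^sup>2 + b\<^sup>2 + c\<^sup>2 + d\<^sup>2) * (p\<^sup>2 + q\<^sup>2 + r\<^sup>2 + s\<^sup>2) =
    (a*p + b*q + c*r + d*s)\<^sup>2 + (a*q - b*p + c*s - d*r)\<^sup>2 +
    (a*r - c*p + d*q - b*s)\<^sup>2 + (a*s - d*p + b*r - c*q)\<^sup>2"
  by algebra

lemma four_squares_mult: "four_squares k \<Longrightarrow> four_squares l \<Longrightarrow> four_squares (k * l)"
  unfolding four_squares_def using euler_four_square_identity by metis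

lemma inj_on_square_mod:
  fixes p :: int assumes "prime p"
  shows "inj_on (\<lambda>x. x\<^sup>2 mod p) {0..(p-1) div 2}"
proof (rule inj_onI)
  fix x y assume xy: "x \<in> {0..(p-1) div 2}" "y \<in> {0..(p-1) div 2}" "x\<^sup>2 mod p = y\<^sup>2 mod p"
  from xy(3) have "p dvd x\<^sup>2 - y\<^sup>2" by (simp add: mod_eq_dvd_iff)
  then have "p dvd (x - y) * (x + y)" by (simp add: power2_eq_square algebra_simps)
  then consider "p dvd x - y" | "p dvd x + y" using assms prime_dvd_mult_iff by blast
  then show "x = y"
  proof cases
    case 1
    moreover have "\<bar>x - y\<bar> < p" using xy prime_gt_0_int[OF assms] by auto
    ultimately show ?thesis using dvd_imp_le_int[of "x - y" p] by fastforce
  next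
    case 2 then show ?thesis using xy zdvd_imp_le[of p "x+y"] by (cases "x + y = 0") auto
  qed
qed

text \<open>
  The \<open>(p + 1) / 2\<close> residues \<open>x\<^sup>2\<close> and the \<open>(p + 1) / 2\<close> residues \<open>- 1 - y\<^sup>2\<close> cannot be disjoint modulo \<open>p\<close>.
\<close>

lemma prime_dvd_sum_two_squares_Suc:
  fixes p :: int assumes p: "prime p" "odd p"
  obtains x y m where "x\<^sup>2 + y\<^sup>2 + 1 = m * p" "0 < m" "m < p"
proof -
  define h where "h = (p - 1) div 2"
  have ph: "p = 2*h+1" "h \<ge> 1" using p prime_ge_2_int[of p] unfolding h_def by (auto elim!: oddE)
  let ?f = "\<lambda>x. x\<^sup>2 mod p" and ?g = "\<lambda>y. (- 1 - y\<^sup>2) mod p"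
  have f: "inj_on ?f {0..h}" using inj_on_square_mod[OF p(1)] by (simp add: h_def)
  have g: "inj_on ?g {0..h}"
  proof (rule inj_onI)
    fix x y assume xy: "x \<in> {0..h}" "y \<in> {0..h}" "?g x = ?g y"
    then have "p dvd (-1 - x\<^sup>2) - (-1 - y\<^sup>2)" by (simp only: mod_eq_dvd_iff)
    then have "y\<^sup>2 mod p = x\<^sup>2 mod p" by (simp add: mod_eq_dvd_iff)
    then show "x = y" using f xy by (auto dest: inj_onD)
  qed
  have "?f ` {0..h} \<inter> ?g ` {0..h} \<noteq> {}"
  proof
    assume "?f ` {0..h} \<inter> ?g ` {0..h} = {}"
    then have "card (?f ` {0..h} \<union> ?g ` {0..h}) = card {0..h} + card {0..h}"
      using f g by (simp add: card_Un_disjoint card_image)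
    moreover have "card (?f ` {0..h} \<union> ?g ` {0..h}) \<le> card {0..<p}"
    proof (intro card_mono)
      have "0 \<le> z mod p" "z mod p < p" for z using p prime_gt_0_int[of p] by auto
      then show "?f ` {0..h} \<union> ?g ` {0..h} \<subseteq> {0..<p}" by auto
    qed simp
    ultimately show False using ph by simp
  qed
  then obtain x y where xy: "x \<in> {0..h}" "y \<in> {0..h}" "?f x = ?g y" by blast
  then have "p dvd x\<^sup>2 - (-1 - y\<^sup>2)" by (simp only: mod_eq_dvd_iff)
  then obtain m where m: "x\<^sup>2 + y\<^sup>2 + 1 = m * p" by (auto simp: dvd_def algebra_simps)
  have "x\<^sup>2 \<le> h\<^sup>2" "y\<^sup>2 \<le> h\<^sup>2" using xy by (auto intro: power_mono)
  moreover have "p * p = h\<^sup>2 + h\<^sup>2 + 1 + (2 * h\<^sup>2 + 4 * h)"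
    by (simp add: ph(1) power2_eq_square algebra_simps)
  then have "h\<^sup>2 + h\<^sup>2 + 1 < p * p" using ph(2) zero_le_power2[of h] by linarith
  ultimately have "m * p < p * p" using m by linarith
  then have "m < p" using ph by simp
  moreover have "0 < m * p" using m by (metis add_nonneg_pos zero_le_power2 add_nonneg_nonneg zero_less_one)
  then have "0 < m" using ph by (simp add: zero_less_mult_iff)
  ultimately show thesis using that m by blast
qed

lemma small_residue:
  fixes a m :: int assumes "m > 0"
  obtains a' k where "a = a' + m * k" "2 * \<bar>a'\<bar> \<le> m"
proof -
  define h s k where "h = m div 2" and "s = (a + h) mod m" and "k = (a + h) div m"
  have "a + h = m * k + s" by (simp add: s_def k_def)
  then have "a = (s - h) + m * k" by simp
  moreover have "0 \<le> s" "s < m" using assms by (auto simp: s_def)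
  moreover have "m = 2 * h \<or> m = 2 * h + 1" unfolding h_def by presburger
  ultimately have "2 * \<bar>s - h\<bar> \<le> m" by (elim disjE) (simp_all add: abs_if)
  with \<open>a = (s - h) + m * k\<close> show thesis by (rule that)
qed

text \<open>
  Lagrange's descent. Reducing the four roots modulo \<open>m\<close> to absolute values at most \<open>m / 2\<close> gives four
  squares with sum \<open>m * r\<close> and \<open>r \<le> m\<close>. Multiplying this with \<open>m * p\<close> by Euler's identity produces four
  squares that are all divisible by \<open>m\<^sup>2\<close>, and cancelling \<open>m\<^sup>2\<close> leaves \<open>r * p\<close>. In the extreme cases
  \<open>r = 0\<close> and \<open>r = m\<close> the sum \<open>m * p\<close> itself would be divisible by \<open>m\<^sup>2\<close>.
\<close>

lemma four_squares_descent:
  fixes m p :: int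
  assumes p: "prime p" and m: "1 < m" "m < p" and mp: "four_squares (m * p)"
  obtains r where "0 < r" "r < m" "four_squares (r * p)"
proof -
  from mp obtain a b c d where abcd: "m * p = a\<^sup>2 + b\<^sup>2 + c\<^sup>2 + d\<^sup>2"
    unfolding four_squares_def by blast
  obtain a' i where a: "a = a' + m * i" "2 * \<bar>a'\<bar> \<le> m" using small_residue[of m a] m by auto
  obtain b' j where b: "b = b' + m * j" "2 * \<bar>b'\<bar> \<le> m" using small_residue[of m b] m by auto
  obtain c' k where c: "c = c' + m * k" "2 * \<bar>c'\<bar> \<le> m" using small_residue[of m c] m by auto
  obtain d' l where d: "d = d' + m * l" "2 * \<bar>d'\<bar> \<le> m" using small_residue[of m d] m by auto
  let ?S = "a'\<^sup>2 + b'\<^sup>2 + c'\<^sup>2 + d'\<^sup>2"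
  define r where "r = p - (2*a'*i + 2*b'*j + 2*c'*k + 2*d'*l) - m * (i\<^sup>2+j\<^sup>2+k\<^sup>2+l\<^sup>2)"
  have r: "?S = m * r"
    using abcd unfolding a(1) b(1) c(1) d(1) r_def by algebra
  have not_dvd: "\<not> m * m dvd m * p"
  proof
    assume "m * m dvd m * p"
    then have "m dvd p" using m by simp
    moreover have "\<forall>q\<ge>0. q dvd p \<longrightarrow> q = 1 \<or> q = p" using p by (simp add: prime_int_iff)
    moreover have "0 \<le> m" using m by simp
    ultimately have "m = 1 \<or> m = p" by blast
    then show False using m by simp
  qed
  have sq: "4 * x\<^sup>2 \<le> m\<^sup>2" if "2 * \<bar>x\<bar> \<le> m" for x :: int
    using power_mono[OF that, of 2] by (simp add: power_mult_distrib)
  note sqs = sq[OF a(2)] sq[OF b(2)] sq[OF c(2)] sq[OF d(2)]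
  have "m * r \<le> m * m" using sqs r by (simp add: power2_eq_square)
  then have "r \<le> m" using m by simp
  moreover have "r \<noteq> m"
  proof
    assume "r = m"
    then have eq: "4 * a'\<^sup>2 = m\<^sup>2" "4 * b'\<^sup>2 = m\<^sup>2" "4 * c'\<^sup>2 = m\<^sup>2" "4 * d'\<^sup>2 = m\<^sup>2"
      using sqs r by (simp_all add: power2_eq_square)
    \<comment> \<open>All four residues are now \<open>m / 2\<close> or \<open>- m / 2\<close>, so their squares also add up to \<open>m\<^sup>2\<close>.\<close>
    have half: "\<exists>z. x\<^sup>2 = x'\<^sup>2 + m * m * z" if "x = x' + m * y" "4 * x'\<^sup>2 = m\<^sup>2" for x x' y
    proof -
      have "(2 * x')\<^sup>2 = m\<^sup>2" using that by (simp add: power_mult_distrib)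
      then have "2 * x' = m \<or> 2 * x' = - m" by (simp only: power2_eq_iff)
      then show ?thesis
      proof
        assume "2 * x' = m"
        then have "x\<^sup>2 = x'\<^sup>2 + m * m * (y + y\<^sup>2)"
          unfolding that(1) by (auto simp: power2_eq_square algebra_simps)
        then show ?thesis by blast
      next
        assume "2 * x' = - m"
        then have m: "m = - 2 * x'" by simp
        have "x\<^sup>2 = x'\<^sup>2 + m * m * (y\<^sup>2 - y)"
          unfolding that(1) m by (simp add: power2_eq_square algebra_simps)
        then show ?thesis by blast
      qed
    qed
    obtain z1 z2 z3 z4 where "a\<^sup>2 = a'\<^sup>2 + m * m * z1" "b\<^sup>2 = b'\<^sup>2 + m * m * z2"
       "c\<^sup>2 = c'\<^sup>2 + m * m * z3" "d\<^sup>2 = d'\<^sup>2 + m * m * z4"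
      using half[OF a(1) eq(1)] half[OF b(1) eq(2)] half[OF c(1) eq(3)] half[OF d(1) eq(4)] by blast
    then have "m * p = m * m * (1 + z1 + z2 + z3 + z4)"
      using abcd r \<open>r = m\<close> by (simp add: algebra_simps)
    then show False using not_dvd by (metis dvd_triv_left)
  qed
  moreover have "0 \<le> m * r" using r by (metis sum_power2_ge_zero add_nonneg_nonneg zero_le_power2)
  then have "0 \<le> r" using m by (simp add: zero_le_mult_iff)
  moreover have "r \<noteq> 0"
  proof
    assume "r = 0"
    then have "?S = 0" using r by simp
    then have "a' = 0" "b' = 0" "c' = 0" "d' = 0"
      by (smt (verit) zero_le_power2 power2_less_eq_zero_iff)+
    then have "m * p = m * m * (i\<^sup>2 + j\<^sup>2 + k\<^sup>2 + l\<^sup>2)"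
      using abcd a b c d by (simp add: power_mult_distrib power2_eq_square algebra_simps)
    then show False using not_dvd by (metis dvd_triv_left)
  qed
  moreover have "four_squares (r * p)"
  proof -
    \<comment> \<open>The right-hand sides are the terms of Euler's identity divided by \<open>m\<close>.\<close>
    define z1 where "z1 = p - (i*a' + j*b' + k*c' + l*d') - m * (i\<^sup>2+j\<^sup>2+k\<^sup>2+l\<^sup>2)"
    define z2 where "z2 = i * b' - j * a' + k * d' - l * c'"
    define z3 where "z3 = i * c' - k * a' + l * b' - j * d'"
    define z4 where "z4 = i * d' - l * a' + j * c' - k * b'"
    have e: "a*a' + b*b' + c*c' + d*d' = m * z1"
      using abcd unfolding a(1) b(1) c(1) d(1) z1_def by algebra
    have e2: "a*b' - b*a' + c*d' - d*c' = m * z2" unfolding a(1) b(1) c(1) d(1) z2_def by algebra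
    have e3: "a*c' - c*a' + d*b' - b*d' = m * z3" unfolding a(1) b(1) c(1) d(1) z3_def by algebra
    have e4: "a*d' - d*a' + b*c' - c*b' = m * z4" unfolding a(1) b(1) c(1) d(1) z4_def by algebra
    have "(m * p) * (m * r) = (m*z1)\<^sup>2 + (m*z2)\<^sup>2 + (m*z3)\<^sup>2 + (m*z4)\<^sup>2"
      unfolding abcd r[symmetric] euler_four_square_identity e e2 e3 e4 ..
    then have "m\<^sup>2 * (r * p) = m\<^sup>2 * (z1\<^sup>2 + z2\<^sup>2 + z3\<^sup>2 + z4\<^sup>2)"
      by (simp add: power_mult_distrib power2_eq_square algebra_simps)
    then show ?thesis unfolding four_squares_def using m by (metis mult_cancel_left power_eq_0_iff not_one_less_zero)
  qed
  ultimately show thesis using that[of r] by linarith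
qed

lemma four_squares_odd_prime:
  fixes p :: int assumes p: "prime p" "odd p"
  shows "four_squares p"
proof -
  have *: "four_squares p" if "0 < m" "m < p" "four_squares (m * p)" for m
    using that
  proof (induction "nat m" arbitrary: m rule: less_induct)
    case less
    show ?case
    proof (cases "m = 1")
      case True then show ?thesis using less.prems by simp
    next
      case False
      then obtain r where r: "0 < r" "r < m" "four_squares (r * p)"
        using four_squares_descent[OF p(1), of m] less.prems by auto
      then show ?thesis using less.hyps[of r] less.prems by auto
    qed
  qed
  obtain x y m where "x\<^sup>2 + y\<^sup>2 + 1 = m * p" "0 < m" "m < p"
    using prime_dvd_sum_two_squares_Suc[OF p] .
  then show ?thesis using *[of m] unfolding four_squares_def
    by (metis add.right_neutral one_power2 zero_power2)
qed

theorem four_squares_odd: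
  fixes k :: nat assumes "odd k" shows "four_squares (int k)"
  using assms
proof (induction k rule: less_induct)
  case (less k)
  show ?case
  proof (cases "k = 1")
    case True
    have "(1::int) = 1\<^sup>2 + 0\<^sup>2 + 0\<^sup>2 + 0\<^sup>2" by simp
    then show ?thesis unfolding four_squares_def True of_nat_1 by blast
  next
    case False
    then obtain p where p: "prime p" "p dvd k" using prime_factor_nat by blast
    then obtain l where l: "k = p * l" by (auto simp: dvd_def)
    have "odd p" "odd l" "l < k" using less.prems l p prime_gt_1_nat[of p] by (auto simp: odd_pos)
    then show ?thesis using four_squares_mult[OF four_squares_odd_prime[of "int p"] less.IH[of l]] p l
      by simp
  qed
qed

section \<open>Triangular numbers\<close>

definition tri :: "nat \<Rightarrow> nat" where "tri k = \<Sum>{1..k}"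

lemma tri_0 [simp]: "tri 0 = 0" by (simp add: tri_def)
lemma tri_Suc [simp]: "tri (Suc k) = tri k + Suc k" by (simp add: tri_def)
lemma double_tri: "2 * tri k = k * (k + 1)" by (induction k) auto
lemma tri_mono: "j \<le> k \<Longrightarrow> tri j \<le> tri k" unfolding tri_def by (intro sum_mono2) auto
lemma tri_ge: "k \<le> tri k" by (induction k) auto
lemma tri_pred_add: "0 < k \<Longrightarrow> tri (k - 1) + tri k = k\<^sup>2"
  using double_tri[of "k - 1"] double_tri[of k] by (cases k) (auto simp: power2_eq_square)
lemma tri_eq_1_iff [simp]: "tri k = Suc 0 \<longleftrightarrow> k = 1"
  using tri_ge[of k] by (cases k; cases "k-1") auto
lemma tri_neq_2: "tri k \<noteq> 2"
proof
  assume "tri k = 2"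
  with tri_ge[of k] have "k = 0 \<or> k = 1 \<or> k = 2" by linarith
  with \<open>tri k = 2\<close> show False by (auto simp: numeral_2_eq_2)
qed

text \<open>
  Consecutive triangular numbers are far apart, so a sum with a large triangular term cannot fall short
  of \<open>tri n\<close> by just a few units.
\<close>

lemma tri_gap:
  assumes "tri x < tri n" shows "tri x + n \<le> tri n"
proof -
  have "x < n" using assms tri_mono[of n x] by linarith
  then have "tri x \<le> tri (n - 1)" by (intro tri_mono) auto
  moreover have "tri (n - 1) + n = tri n" using \<open>x < n\<close> by (cases n) auto
  ultimately show ?thesis by linarith
qed

lemma odd_square_eq_tri:
  fixes p :: int assumes "odd p" obtains k where "p\<^sup>2 = 8 * int (tri k) + 1"
proof -
  have "odd \<bar>p\<bar>" using assms by simp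
  then obtain m where m: "\<bar>p\<bar> = 2 * m + 1" by (rule oddE)
  define k where "k = nat m"
  have "\<bar>p\<bar> = 2 * int k + 1" using m by (simp add: k_def)
  then have "p\<^sup>2 = (2 * int k + 1)\<^sup>2" by (metis power2_abs)
  also have "\<dots> = 4 * int (2 * tri k) + 1" unfolding double_tri by (simp add: power2_eq_square algebra_simps)
  finally show thesis using that[of k] by simp
qed

text \<open>
  For \<open>2 * N + 1 = a\<^sup>2 + b\<^sup>2 + c\<^sup>2 + d\<^sup>2\<close> the four numbers \<open>a \<plusminus> b \<plusminus> c \<plusminus> d\<close> with an even number of minus signs
  are odd, and the sum of their squares is \<open>4 * (2 * N + 1) = 8 * N + 4\<close>. An odd square is one more than
  eight times a triangular number.
\<close>

theorem four_triangular_numbers: "\<exists>a b c d. tri a + tri b + tri c + tri d = N"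
proof -
  obtain a b c d where e: "int (2*N+1) = a\<^sup>2 + b\<^sup>2 + c\<^sup>2 + d\<^sup>2"
    using four_squares_odd[of "2*N+1"] unfolding four_squares_def by auto
  have "odd (a\<^sup>2 + b\<^sup>2 + c\<^sup>2 + d\<^sup>2)" unfolding e[symmetric] by simp
  then have "odd (a + b + c + d)" "odd (a + b - c - d)" "odd (a - b + c - d)" "odd (a - b - c + d)"
    by auto
  then obtain i j k l where
    "(a + b + c + d)\<^sup>2 = 8 * int (tri i) + 1" "(a + b - c - d)\<^sup>2 = 8 * int (tri j) + 1"
    "(a - b + c - d)\<^sup>2 = 8 * int (tri k) + 1" "(a - b - c + d)\<^sup>2 = 8 * int (tri l) + 1"
    using odd_square_eq_tri by metis
  moreover have "(a + b + c + d)\<^sup>2 + (a + b - c - d)\<^sup>2 + (a - b + c - d)\<^sup>2 + (a - b - c + d)\<^sup>2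
      = 4 * (a\<^sup>2 + b\<^sup>2 + c\<^sup>2 + d\<^sup>2)" by algebra
  ultimately have "8 * int (tri i + tri j + tri k + tri l) + 4 = 4 * int (2 * N + 1)"
    unfolding e by simp
  then have "int (tri i + tri j + tri k + tri l) = int N" by simp
  then have "tri i + tri j + tri k + tri l = N" by (simp only: of_nat_eq_iff)
  then show ?thesis by blast
qed

lemma sort_four:
  fixes f :: "nat \<Rightarrow> nat"
  obtains x y z w where "y \<le> x" "z \<le> y" "w \<le> z" "x + y + z + w = a + b + c + d"
    "f x + f y + f z + f w = f a + f b + f c + f d"
proof -
  define xs where "xs = sort [a, b, c, d]"
  have "length xs = 4" by (simp add: xs_def)
  then obtain w z y x where xs: "xs = [w, z, y, x]"
    by (auto simp: numeral_eq_Suc length_Suc_conv)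
  have "sorted xs" by (simp add: xs_def)
  moreover have "mset xs = mset [a, b, c, d]" by (simp add: xs_def)
  then have "sum_mset (mset xs) = sum_mset (mset [a, b, c, d])"
    "sum_mset (image_mset f (mset xs)) = sum_mset (image_mset f (mset [a, b, c, d]))" by presburger+
  ultimately show thesis using that[of y x z w] unfolding xs by (auto simp: algebra_simps)
qed

text \<open>
  The four indices will be paired as \<open>z, x\<close> and \<open>w, y\<close>, and a pair of two ones or two fours is awkward to
  handle. With the indices in order, such a pair forces three equal indices. A representation with minimal
  index sum avoids this, because \<open>3 * tri 1 = tri 2\<close> and \<open>3 * tri 4 = tri 7 + 2 * tri 1\<close>.
\<close>

lemma four_triangular_numbers_spread:
  obtains x y z w where "y \<le> x" "z \<le> y" "w \<le> z" "tri x + tri y + tri z + tri w = N"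
    "x = z \<Longrightarrow> x \<noteq> 1 \<and> x \<noteq> 4" "y = w \<Longrightarrow> y \<noteq> 1 \<and> y \<noteq> 4"
proof -
  define P where "P s \<longleftrightarrow> (\<exists>a b c d. a + b + c + d = s \<and> tri a + tri b + tri c + tri d = N)" for s
  have "\<exists>s. P s" unfolding P_def using four_triangular_numbers[of N] by blast
  then have least: "P (LEAST s. P s)" by (rule LeastI_ex)
  then obtain a b c d where abcd: "a + b + c + d = (LEAST s. P s)" "tri a + tri b + tri c + tri d = N"
    unfolding P_def by blast
  obtain x y z w where o: "y \<le> x" "z \<le> y" "w \<le> z" and s: "x + y + z + w = (LEAST s. P s)"
    and N: "tri x + tri y + tri z + tri w = N"
    using sort_four[of a b c d tri] abcd by metis
  have min: "x + y + z + w \<le> p + q + r + t" if "tri p + tri q + tri r + tri t = N" for p q r t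
    unfolding s by (rule Least_le) (use that P_def in blast)
  have *: "tri 2 = 3" "tri 4 = 10" "tri 7 = 28" by (simp_all add: tri_def atLeastAtMostSuc_conv numeral_eq_Suc)
  have "x \<noteq> 1 \<and> x \<noteq> 4" if "x = z"
    using that o N min[of 2 w 0 0] min[of 7 1 1 w] by (auto simp: *)
  moreover have "y \<noteq> 1 \<and> y \<noteq> 4" if "y = w"
    using that o N min[of 2 x 0 0] min[of 7 1 1 x] by (auto simp: *)
  ultimately show thesis using that o N by blast
qed

section \<open>Subset sums\<close>

text \<open>
  The two bounds are the least and the greatest sum of \<open>j\<close> elements of \<open>{u<..n}\<close>; every value in between is
  attained as well.
\<close>

lemma subset_sum_of_card:
  assumes "j * u + tri j \<le> m" "m + tri (j - 1) \<le> j * n"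
  shows "\<exists>D\<subseteq>{u<..n}. \<Sum>D = m"
  using assms
proof (induction j arbitrary: m n)
  case 0
  then show ?case by (intro exI[of _ "{}"]) auto
next
  case (Suc j)
  \<comment> \<open>The largest element: as big as possible while \<open>j\<close> smaller ones can still be fitted in.\<close>
  define a where "a = min n (m - (j * u + tri j))"
  have tj: "tri j = tri (j - 1) + j" by (cases j) auto
  have "Suc j * u + Suc j * Suc j \<le> Suc j * n" using Suc.prems double_tri[of j] by (simp add: algebra_simps)
  then have "Suc j * (u + Suc j) \<le> Suc j * n" by (simp add: algebra_simps)
  then have "u + Suc j \<le> n" by (subst (asm) mult_le_cancel1) simp
  then have a: "u + Suc j \<le> a" "a \<le> n" "a + (j * u + tri j) \<le> m" using Suc.prems(1) by (auto simp: a_def)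
  have "m - a + tri (j - 1) \<le> j * (a - 1)"
  proof (cases "a = n")
    case True
    then show ?thesis using Suc.prems(2) a tj by (simp add: algebra_simps diff_mult_distrib2)
  next
    case False
    then have "m - a = j * u + tri j" using a by (auto simp: a_def)
    moreover have "tri j + tri (j - 1) = j * j" using tri_pred_add[of j] by (cases j) (auto simp: power2_eq_square)
    moreover have "j * (u + j) \<le> j * (a - 1)" using a by (intro mult_le_mono) auto
    ultimately show ?thesis by (simp add: algebra_simps)
  qed
  moreover have "j * u + tri j \<le> m - a" using a by simp
  ultimately obtain D where D: "D \<subseteq> {u<..a - 1}" "\<Sum>D = m - a" using Suc.IH[of "m - a" "a - 1"] by blast
  have "finite D" "a \<notin> D" using D(1) a by (auto dest: finite_subset)
  then have "\<Sum>(insert a D) = m" using D a by simp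
  moreover have "insert a D \<subseteq> {u<..n}" using D(1) a by fastforce
  ultimately show ?case by blast
qed

text \<open>
  The sums of \<open>j\<close> elements of \<open>{u<..n}\<close> fill an interval, and for a moderate number of elements the intervals
  belonging to \<open>j\<close> and \<open>j + 1\<close> overlap or touch. The weight bound makes \<open>u\<close> smaller than \<open>n / 2\<close> and keeps
  \<open>tri v\<close> well below the sum of all of \<open>{u<..n}\<close>, so only small gaps matter. The excluded pairs are genuine
  exceptions: \<open>1\<close> is not a sum of elements of \<open>{1<..n}\<close>, and \<open>10 = tri 4\<close> is not one of elements of \<open>{4<..9}\<close>.
\<close>

lemma tri_subset_sum_above:
  assumes n: "9 \<le> n" and uv: "u \<le> v" "2 * (tri u + tri v) \<le> tri n"
    and ne: "u = v \<Longrightarrow> u \<noteq> 1 \<and> u \<noteq> 4"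
  shows "\<exists>D\<subseteq>{u<..n}. \<Sum>D = tri v"
proof -
  have "4 * tri u \<le> tri n" using uv(2) tri_mono[OF uv(1)] by simp
  then have "4 * (u * (u + 1)) \<le> n * (n + 1)" using double_tri[of u] double_tri[of n] by linarith
  have un: "2 * u + 1 \<le> n"
  proof (rule ccontr)
    assume "\<not> 2 * u + 1 \<le> n"
    then have "n * (n + 1) \<le> (2 * u) * (2 * u + 1)" by (intro mult_le_mono) auto
    also have "\<dots> < 4 * (u * (u + 1))" using n \<open>\<not> _\<close> by (simp add: algebra_simps)
    finally show False using \<open>4 * (u * (u + 1)) \<le> n * (n + 1)\<close> by simp
  qed
  consider "v = 0" | "0 < v" "tri v \<le> n" | "n < tri v" by linarith
  then show ?thesis
  proof cases
    case 1
    then show ?thesis by (intro exI[of _ "{}"]) simp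
  next
    case 2
    have "u < tri v"
    proof (cases "u < v")
      case True then show ?thesis using tri_ge[of v] by linarith
    next
      case False
      then have "1 < v" using uv ne 2 by force
      then show ?thesis using False uv tri_ge[of "v - 1"] by (cases v) auto
    qed
    then show ?thesis using 2 by (intro exI[of _ "{tri v}"]) auto
  next
    case 3
    have tn: "n * 10 \<le> 2 * tri n" using n double_tri[of n] by simp
    \<comment> \<open>The least sum of two elements of \<open>{u<..n}\<close> is \<open>2 * u + 3\<close>; only \<open>n + 1 = 2 * u + 2\<close> could be missed.\<close>
    have low: "2 * u + 3 \<le> tri v"
    proof (rule ccontr)
      assume "\<not> 2 * u + 3 \<le> tri v"
      then have e: "n = 2 * u + 1" "tri v = 2 * u + 2" using un 3 by auto
      have "tri u \<le> 2 * u + 2" using tri_mono[OF uv(1)] e by simp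
      then have "u * u \<le> 3 * u + 4" using double_tri[of u] by simp
      have "u \<le> 4"
      proof (rule ccontr)
        assume "\<not> u \<le> 4"
        then have "5 * u \<le> u * u" by simp
        then show False using \<open>u * u \<le> 3 * u + 4\<close> \<open>\<not> u \<le> 4\<close> by linarith
      qed
      then have "u = 4" using e n by simp
      moreover have "tri 4 = 10" "tri 5 = 15" by (simp_all add: tri_def atLeastAtMostSuc_conv numeral_eq_Suc)
      then have "v = 4" using e \<open>u = 4\<close> uv(1) tri_mono[of 5 v] by (cases "v \<ge> 5") auto
      ultimately show False using ne by simp
    qed
    \<comment> \<open>\<open>P j\<close> says that \<open>tri v\<close> does not exceed the greatest sum of \<open>j\<close> elements. The least such \<open>j\<close> works.\<close>
    \<comment> \<open>\<open>J\<close> is two less than the size of \<open>{u<..n}\<close>, and up to there the intervals of sums overlap.\<close>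
    define P where "P j \<longleftrightarrow> tri v + tri (j - 1) \<le> j * n" for j
    define J where "J = n - u - 2"
    have J: "1 \<le> J" "n = J + u + 2" using un n by (auto simp: J_def)
    have "P J"
    proof -
      have "tri n + tri (J - 1) = J * n + tri (u + 2)"
        using double_tri[of n] double_tri[of "J - 1"] double_tri[of "u + 2"] J
        by (cases J) (auto simp: algebra_simps)
      moreover have "tri (u + 2) = tri u + 2 * u + 3" by (simp add: numeral_eq_Suc)
      moreover have "2 * tri u + 2 * tri v \<le> tri n" using uv(2) by simp
      ultimately show ?thesis unfolding P_def using tn un by linarith
    qed
    define j where "j = (LEAST j. P j)"
    have Pj: "P j" "j \<le> J" unfolding j_def using \<open>P J\<close> by (auto intro: LeastI Least_le)
    have "\<not> P 0" "\<not> P 1" using 3 by (simp_all add: P_def)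
    then have "j \<noteq> 0" "j \<noteq> 1" using Pj(1) by metis+
    have "j * u + tri j \<le> tri v"
    proof (cases "j = 2")
      case True then show ?thesis using low by (simp add: numeral_eq_Suc)
    next
      case False
      define c e where "c = j - 1" and "e = n - u - 1 - c"
      have ce: "j = c + 1" "2 \<le> c" "2 \<le> e" "n = c + e + u + 1"
        using False \<open>j \<noteq> 0\<close> \<open>j \<noteq> 1\<close> Pj(2) J by (auto simp: c_def e_def)
      have "\<not> P c" using not_less_Least[of c P] ce(1) unfolding j_def by simp
      then have "c * n < tri v + tri (c - 1)" by (simp add: P_def)
      moreover have "tri (c + 1) + tri (c - 1) = c * c + c + 1"
        using double_tri[of "c + 1"] double_tri[of "c - 1"] ce by (cases c) auto
      moreover have "u \<le> c * e"
      proof -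
        \<comment> \<open>\<open>(c - 2) * (e - 2) \<ge> 0\<close> bounds the product from below by the sum, which \<open>n\<close> controls.\<close>
        obtain c' e' where "c = c' + 2" "e = e' + 2" using ce by (metis le_add_diff_inverse2)
        then show ?thesis using ce(4) un n by (simp add: algebra_simps)
      qed
      then have "(c + 1) * u + c * c + c \<le> c * n" unfolding ce(4) by (simp add: algebra_simps)
      ultimately show ?thesis unfolding ce(1) by (simp add: algebra_simps)
    qed
    then show ?thesis using subset_sum_of_card[of j u "tri v" n] Pj(1) by (simp add: P_def)
  qed
qed

lemma subset_sum_initial: "m \<le> tri k \<Longrightarrow> \<exists>D\<subseteq>{1..k}. \<Sum>D = m"
proof (induction k arbitrary: m)
  case 0 then show ?case by auto
next
  case (Suc k)
  show ?case
  proof (cases "m \<le> tri k")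
    case True
    then show ?thesis using Suc.IH[of m] by (meson atLeastatMost_subset_iff dual_order.trans le_SucI order_refl)
  next
    case False
    then have km: "k < m" using tri_ge[of k] by simp
    have "m - Suc k \<le> tri k" using Suc.prems by simp
    then obtain D where D: "D \<subseteq> {1..k}" "\<Sum>D = m - Suc k" using Suc.IH by blast
    then have "finite D" "Suc k \<notin> D" by (auto dest: finite_subset)
    then have "\<Sum>(insert (Suc k) D) = m" using D km by simp
    moreover have "insert (Suc k) D \<subseteq> {1..Suc k}" using D by auto
    ultimately show ?thesis by blast
  qed
qed

section \<open>Partitions into three parts with prescribed sums\<close>

text \<open>
  Only \<open>{1}\<close> has sum \<open>1\<close> and only \<open>{2}\<close> has sum \<open>2\<close>, so disjoint sets of positive integers cannot realise a
  triple with a clash. This turns out to be the only obstruction to a partition.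
\<close>

definition clash :: "nat \<Rightarrow> nat \<Rightarrow> nat \<Rightarrow> bool" where
  "clash a b c \<longleftrightarrow> (\<exists>k\<in>{1,2}. (a = k \<and> b = k) \<or> (a = k \<and> c = k) \<or> (b = k \<and> c = k))"

lemma clash_commute: "clash a b c = clash b a c" unfolding clash_def by blast
lemma clash_rotate: "clash a b c = clash c a b" unfolding clash_def by blast

text \<open>
  Partitions of \<open>{1..n}\<close> described by a search: the largest element goes to one of the three parts. In this
  form the cases of a fixed \<open>n\<close> can be computed.
\<close>

fun splits :: "nat \<Rightarrow> nat \<Rightarrow> nat \<Rightarrow> nat \<Rightarrow> bool" where
  "splits 0 a b c \<longleftrightarrow> a = 0 \<and> b = 0 \<and> c = 0"
| "splits (Suc n) a b c \<longleftrightarrow>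
     Suc n \<le> a \<and> splits n (a - Suc n) b c \<or>
     Suc n \<le> b \<and> splits n a (b - Suc n) c \<or>
     Suc n \<le> c \<and> splits n a b (c - Suc n)"

lemma extend_partition:
  assumes "X \<union> Y \<union> Z = {1..n}" "X \<inter> Y = {}" "X \<inter> Z = {}"
  shows "insert (Suc n) X \<union> Y \<union> Z = {1..Suc n}" "insert (Suc n) X \<inter> Y = {}"
    "insert (Suc n) X \<inter> Z = {}" "\<Sum>(insert (Suc n) X) = \<Sum>X + Suc n"
proof -
  have notin: "Suc n \<notin> X \<union> Y \<union> Z" unfolding assms(1) by simp
  have "insert (Suc n) X \<union> Y \<union> Z = insert (Suc n) (X \<union> Y \<union> Z)" by blast
  then show "insert (Suc n) X \<union> Y \<union> Z = {1..Suc n}" unfolding assms(1) by (simp add: atLeastAtMostSuc_conv)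
  show "insert (Suc n) X \<inter> Y = {}" "insert (Suc n) X \<inter> Z = {}" using notin assms by blast+
  have "finite (X \<union> Y \<union> Z)" unfolding assms(1) by simp
  then show "\<Sum>(insert (Suc n) X) = \<Sum>X + Suc n" using notin by simp
qed

lemma splits_imp_partition:
  "splits n a b c \<Longrightarrow> \<exists>X Y Z. X \<union> Y \<union> Z = {1..n} \<and> X \<inter> Y = {} \<and> X \<inter> Z = {} \<and> Y \<inter> Z = {} \<and>
     \<Sum>X = a \<and> \<Sum>Y = b \<and> \<Sum>Z = c"
proof (induction n arbitrary: a b c)
  case 0
  then show ?case by (intro exI[of _ "{}"]) simp
next
  case (Suc n)
  from Suc.prems consider "Suc n \<le> a" "splits n (a - Suc n) b c" | "Suc n \<le> b" "splits n a (b - Suc n) c" |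
     "Suc n \<le> c" "splits n a b (c - Suc n)" unfolding splits.simps by blast
  then show ?case
  proof cases
    case 1
    from Suc.IH[OF 1(2)] obtain X Y Z where *: "X \<union> Y \<union> Z = {1..n}" "X \<inter> Y = {}" "X \<inter> Z = {}" "Y \<inter> Z = {}"
       "\<Sum>X = a - Suc n" "\<Sum>Y = b" "\<Sum>Z = c" by blast
    note ext = extend_partition[OF *(1,2,3)]
    have "\<Sum>(insert (Suc n) X) = a" using ext(4) *(5) 1(1) by linarith
    with ext(1-3) *(4,6,7) show ?thesis by blast
  next
    case 2
    from Suc.IH[OF 2(2)] obtain X Y Z where *: "X \<union> Y \<union> Z = {1..n}" "X \<inter> Y = {}" "X \<inter> Z = {}" "Y \<inter> Z = {}"
       "\<Sum>X = a" "\<Sum>Y = b - Suc n" "\<Sum>Z = c" by blast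
    have "Y \<union> X \<union> Z = {1..n}" "Y \<inter> X = {}" using *(1,2) by blast+
    note ext = extend_partition[OF this *(4)]
    have "\<Sum>(insert (Suc n) Y) = b" using ext(4) *(6) 2(1) by linarith
    moreover have "X \<union> insert (Suc n) Y \<union> Z = {1..Suc n}" "X \<inter> insert (Suc n) Y = {}"
      using ext(1,2) by blast+
    ultimately show ?thesis using ext(3) *(3,5,7) by blast
  next
    case 3
    from Suc.IH[OF 3(2)] obtain X Y Z where *: "X \<union> Y \<union> Z = {1..n}" "X \<inter> Y = {}" "X \<inter> Z = {}" "Y \<inter> Z = {}"
       "\<Sum>X = a" "\<Sum>Y = b" "\<Sum>Z = c - Suc n" by blast
    have "Z \<union> X \<union> Y = {1..n}" "Z \<inter> X = {}" "Z \<inter> Y = {}" using *(1,3,4) by blast+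
    note ext = extend_partition[OF this]
    have "\<Sum>(insert (Suc n) Z) = c" using ext(4) *(7) 3(1) by linarith
    moreover have "X \<union> Y \<union> insert (Suc n) Z = {1..Suc n}" "X \<inter> insert (Suc n) Z = {}" "Y \<inter> insert (Suc n) Z = {}"
      using ext(1-3) by blast+
    ultimately show ?thesis using *(2,5,6) by blast
  qed
qed

lemma splits_5: "\<forall>a\<in>{0..15}. \<forall>b\<in>{0..15-a}. clash a b (15 - a - b) \<or> splits 5 a b (15 - a - b)"
  by code_simp

text \<open>
  The largest of the three sums is at least a third of \<open>tri n\<close>, hence at least \<open>n\<close>, and takes the element \<open>n\<close>.
  This could create a clash only if that sum were at most \<open>n + 2\<close> and another one at most \<open>2\<close>, which is too
  little in total from \<open>n = 6\<close> on. The case \<open>n = 5\<close> is computed.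
\<close>

lemma splits_of_not_clash:
  assumes "5 \<le> n" "a + b + c = tri n" "\<not> clash a b c"
  shows "splits n a b c"
  using assms
proof (induction n arbitrary: a b c rule: nat_induct_at_least)
  case base
  have "tri 5 = 15" by (simp add: numeral_eq_Suc)
  then have "a \<in> {0..15}" "b \<in> {0..15 - a}" "c = 15 - a - b" using base by auto
  then show ?case using base splits_5 by blast
next
  case (Suc n)
  have "7 * Suc n \<le> (n + 2) * Suc n" using Suc.hyps by (intro mult_le_mono) auto
  then have big: "7 * n + 7 \<le> 2 * tri (Suc n)" unfolding double_tri by (simp add: algebra_simps)
  have step: "Suc n \<le> x \<and> \<not> clash (x - Suc n) y z"
    if "x + y + z = tri (Suc n)" "y \<le> x" "z \<le> x" "\<not> clash x y z" for x y z
  proof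
    show "Suc n \<le> x" using that(1-3) big by linarith
    show "\<not> clash (x - Suc n) y z"
    proof
      assume "clash (x - Suc n) y z"
      with that(4) have "x \<le> n + 3 \<and> (y \<le> 2 \<or> z \<le> 2)" unfolding clash_def by auto
      then show False using that(1-3) big Suc.hyps by linarith
    qed
  qed
  have IH: "splits n x y z" if "x + y + z + Suc n = tri (Suc n)" "\<not> clash x y z" for x y z
    by (rule Suc.IH) (use that in auto)
  consider "b \<le> a" "c \<le> a" | "a \<le> b" "c \<le> b" | "a \<le> c" "b \<le> c" by linarith
  then show ?case
  proof cases
    case 1
    have "Suc n \<le> a" "\<not> clash (a - Suc n) b c" using step[of a b c] 1 Suc.prems by auto
    then show ?thesis using IH[of "a - Suc n" b c] Suc.prems(1) by (simp del: tri_Suc)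
  next
    case 2
    have "Suc n \<le> b" "\<not> clash a (b - Suc n) c"
      using step[of b a c] 2 Suc.prems clash_commute[of a "b - Suc n" c] clash_commute[of a b c]
      by (simp_all add: add_ac del: tri_Suc)
    then show ?thesis using IH[of a "b - Suc n" c] Suc.prems(1) by (simp del: tri_Suc)
  next
    case 3
    have "Suc n \<le> c" "\<not> clash a b (c - Suc n)"
      using step[of c a b] 3 Suc.prems clash_rotate[of a b "c - Suc n"] clash_rotate[of a b c]
      by (simp_all add: add_ac del: tri_Suc)
    then show ?thesis using IH[of a b "c - Suc n"] Suc.prems(1) by (simp del: tri_Suc)
  qed
qed

lemma partition_three_sums:
  assumes "5 \<le> n" "a + b + c = tri n" "\<not> clash a b c"
  obtains X Y Z where "X \<union> Y \<union> Z = {1..n}" "X \<inter> Y = {}" "X \<inter> Z = {}" "Y \<inter> Z = {}"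
     "\<Sum>X = a" "\<Sum>Y = b" "\<Sum>Z = c"
  using splits_imp_partition[OF splits_of_not_clash[OF assms]] by metis

section \<open>Weighings as comparisons of sums\<close>

text \<open>
  Coins that lie in both sets are left out, which does not change the difference of the two sides.
\<close>

definition weigh :: "nat set \<Rightarrow> nat set \<Rightarrow> weighing" where
  "weigh X Y = (X - Y, Y - X)"

lemma is_weighing_weigh: "X \<subseteq> {1..n} \<Longrightarrow> Y \<subseteq> {1..n} \<Longrightarrow> is_weighing n (weigh X Y)"
  by (auto simp: is_weighing_def weigh_def)

definition consistent :: "weighing list \<Rightarrow> (nat \<Rightarrow> nat) \<Rightarrow> bool" where
  "consistent Ws w \<longleftrightarrow> (\<forall>W\<in>set Ws. outcome_of w W = outcome_of id W)"

lemma consistent_append [simp]: "consistent (Ws @ Vs) w \<longleftrightarrow> consistent Ws w \<and> consistent Vs w"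
  and consistent_Cons: "consistent (W # Ws) w \<longleftrightarrow> consistent [W] w \<and> consistent Ws w"
  by (auto simp: consistent_def)

lemma outcome_of_weigh:
  assumes "finite X" "finite Y"
  shows "outcome_of w (weigh X Y) =
    (if sum w X < sum w Y then Less else if sum w X = sum w Y then Equal else Greater)"
proof -
  have "sum w X = sum w (X - Y) + sum w (X \<inter> Y)" "sum w Y = sum w (Y - X) + sum w (X \<inter> Y)"
    using assms by (metis add.commute sum.Int_Diff, metis add.commute sum.Int_Diff Int_commute)
  then show ?thesis by (simp add: outcome_of_def weigh_def)
qed

lemma consistent_weigh:
  assumes "consistent [weigh X Y] w" "X \<subseteq> {1..n}" "Y \<subseteq> {1..n}"
  shows "\<Sum>X = \<Sum>Y \<Longrightarrow> sum w X = sum w Y"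
    and "\<Sum>X < \<Sum>Y \<Longrightarrow> sum w X < sum w Y"
proof -
  have "finite X" "finite Y" using assms(2,3) finite_subset by blast+
  then have "outcome_of w (weigh X Y) = outcome_of id (weigh X Y)"
      "\<And>v. outcome_of v (weigh X Y) =
    (if sum v X < sum v Y then Less else if sum v X = sum v Y then Equal else Greater)"
    using assms(1) outcome_of_weigh by (auto simp: consistent_def)
  then show "\<Sum>X = \<Sum>Y \<Longrightarrow> sum w X = sum w Y" "\<Sum>X < \<Sum>Y \<Longrightarrow> sum w X < sum w Y"
    by (auto simp: split: if_splits)
qed

text \<open>
  The \<open>k\<close> smallest positive integers have the smallest sum among all sets of \<open>k\<close> positive integers.
\<close>

lemma tri_card_le_sum:
  assumes "finite S" "0 \<notin> S" shows "tri (card S) \<le> \<Sum>S"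
  using assms
proof (induction S rule: finite_linorder_max_induct)
  case empty then show ?case by simp
next
  case (insert b A)
  have "A \<subseteq> {1..<b}" using insert by (auto simp: Suc_le_eq intro: gr0I)
  then have "card A \<le> b - 1" using card_mono[of "{1..<b}" A] by simp
  moreover have "0 < b" using insert.prems by (auto intro: gr0I)
  moreover have "b \<notin> A" using insert.hyps by blast
  ultimately show ?case using insert by simp
qed

lemma tri_le_sum_prefix:
  assumes "w permutes {1..n}" shows "tri b \<le> sum w {1..b}"
proof -
  have inj: "inj w" using assms by (rule permutes_inj)
  have "w 0 = 0" using assms by (auto simp: permutes_def)
  then have "0 \<notin> w ` {1..b}" using inj by (metis imageE atLeastAtMost_iff injD not_one_le_zero)
  then have "tri (card (w ` {1..b})) \<le> \<Sum>(w ` {1..b})" by (intro tri_card_le_sum) auto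
  moreover have "inj_on w {1..b}" using inj by (rule inj_on_subset) simp
  ultimately show ?thesis by (simp add: card_image sum.reindex)
qed

section \<open>Trading two prefixes for one set\<close>

text \<open>
  With \<open>k\<close> weighings the audience learns that the prefixes \<open>{1..u}\<close> and \<open>{1..v}\<close> together weigh as much as \<open>A\<close>
  plus the known constant \<open>c\<close>. The constant is \<open>0\<close>, except when all coins together have been used once and
  \<open>c = tri n\<close>.
\<close>

definition merges :: "nat \<Rightarrow> nat \<Rightarrow> nat \<Rightarrow> nat \<Rightarrow> nat \<Rightarrow> nat set \<Rightarrow> bool" where
  "merges n k u v c A \<longleftrightarrow> A \<subseteq> {1..n} \<and> tri u + tri v = \<Sum>A + c \<and>
     (\<exists>Ws. length Ws \<le> k \<and> (\<forall>W\<in>set Ws. is_weighing n W) \<and>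
        (\<forall>w. w permutes {1..n} \<and> consistent Ws w \<longrightarrow>
             sum w {1..u} + sum w {1..v} = sum w A + c))"

lemma tri_le_imp_le: "tri v \<le> tri n \<Longrightarrow> v \<le> n"
  using tri_mono[of "Suc n" v] by (cases "v \<le> n") auto

text \<open>
  The set \<open>D\<close> that balances \<open>{1..v}\<close> avoids \<open>{1..u}\<close>, so the union of \<open>D\<close> and \<open>{1..u}\<close> is disjoint.
\<close>

lemma merges_one_weighing:
  assumes "9 \<le> n" "u \<le> v" "2 * (tri u + tri v) \<le> tri n" "u = v \<Longrightarrow> u \<noteq> 1 \<and> u \<noteq> 4"
  shows "\<exists>A. merges n 1 u v 0 A"
proof -
  obtain D where D: "D \<subseteq> {u<..n}" "\<Sum>D = tri v" using tri_subset_sum_above[OF assms] by blast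
  have sub: "{1..v} \<subseteq> {1..n}" "D \<subseteq> {1..n}" "{1..u} \<union> D \<subseteq> {1..n}"
    using tri_le_imp_le[of v n] assms D(1) by auto
  have "{1..u} \<inter> D = {}" using D(1) by auto
  then have s: "sum f ({1..u} \<union> D) = sum f {1..u} + sum f D" for f :: "nat \<Rightarrow> nat"
    using finite_subset[OF sub(2)] by (simp add: sum.union_disjoint)
  have "merges n 1 u v 0 ({1..u} \<union> D)"
    unfolding merges_def
  proof (intro conjI exI[of _ "[weigh {1..v} D]"] allI impI)
    show "tri u + tri v = \<Sum>({1..u} \<union> D) + 0" using D(2) s[of "\<lambda>x. x"] by (simp add: tri_def)
    fix w assume "w permutes {1..n} \<and> consistent [weigh {1..v} D] w"
    then have "sum w {1..v} = sum w D"
      using consistent_weigh(1)[OF _ sub(1,2)] D(2) by (simp add: tri_def)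
    then show "sum w {1..u} + sum w {1..v} = sum w ({1..u} \<union> D) + 0" using s[of w] by linarith
  qed (use sub is_weighing_weigh in auto)
  then show ?thesis by blast
qed

text \<open>
  Both prefixes are replaced by disjoint sets of the same weights, taken from a partition whose third part
  collects the remaining coins. Three summands clash here only if \<open>u = v = 1\<close>, because \<open>2\<close> is not triangular
  and \<open>tri_gap\<close> excludes a remainder of \<open>1\<close> next to a part of sum \<open>1\<close>.
\<close>

lemma merges_two_weighings:
  assumes "5 \<le> n" "tri u + tri v \<le> tri n" "\<not> (u = 1 \<and> v = 1)"
  shows "\<exists>A. merges n 2 u v 0 A"
proof -
  have "\<not> clash (tri u) (tri v) (tri n - tri u - tri v)"
    using tri_gap[of u n] tri_gap[of v n] assms by (auto simp: clash_def tri_neq_2)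
  moreover have "tri u + tri v + (tri n - tri u - tri v) = tri n" using assms(2) by simp
  ultimately obtain C D R where P: "C \<union> D \<union> R = {1..n}" "C \<inter> D = {}" "\<Sum>C = tri u" "\<Sum>D = tri v"
    using partition_three_sums[OF assms(1)] by metis
  have sub: "{1..u} \<subseteq> {1..n}" "{1..v} \<subseteq> {1..n}" "C \<subseteq> {1..n}" "D \<subseteq> {1..n}"
    using tri_le_imp_le[of u n] tri_le_imp_le[of v n] assms(2) P(1) by auto
  have s: "sum f (C \<union> D) = sum f C + sum f D" for f :: "nat \<Rightarrow> nat"
    using P(2) sub(3,4) finite_subset[of _ "{1..n}"] by (simp add: sum.union_disjoint)
  have "merges n 2 u v 0 (C \<union> D)"
    unfolding merges_def
  proof (intro conjI exI[of _ "[weigh {1..u} C, weigh {1..v} D]"] allI impI)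
    show "tri u + tri v = \<Sum>(C \<union> D) + 0" using P(3,4) s[of "\<lambda>x. x"] by simp
    fix w assume "w permutes {1..n} \<and> consistent [weigh {1..u} C, weigh {1..v} D] w"
    then have "sum w {1..u} = sum w C" "sum w {1..v} = sum w D"
      using consistent_weigh(1)[OF _ sub(1,3)] consistent_weigh(1)[OF _ sub(2,4)] P(3,4)
      by (auto simp: tri_def consistent_Cons[of _ "[_]"])
    then show "sum w {1..u} + sum w {1..v} = sum w (C \<union> D) + 0" by (simp add: s)
  qed (use sub is_weighing_weigh in auto)
  then show ?thesis by blast
qed

text \<open>
  The prefixes \<open>{1..t - 1}\<close> and \<open>{1..t}\<close> are heavier than all coins together. The excess is the weight of some
  \<open>D \<subseteq> {1..t - 1}\<close>, and \<open>{1..t - 1}\<close> balances \<open>{t<..n} \<union> D\<close>; adding \<open>{1..t}\<close> on both sides completes \<open>{t<..n}\<close>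
  to \<open>{1..n}\<close>.
\<close>

lemma merges_overflow:
  assumes t: "1 \<le> t" "t \<le> n" and big: "tri n \<le> t\<^sup>2"
  shows "\<exists>A. merges n 1 (t - 1) t (tri n) A"
proof -
  have tt: "tri (t - 1) + tri t = t\<^sup>2" using tri_pred_add t by simp
  have "tri t \<le> tri n" using t by (intro tri_mono)
  then have "t\<^sup>2 - tri n \<le> tri (t - 1)" using tt by linarith
  then obtain D where D: "D \<subseteq> {1..t - 1}" "\<Sum>D = t\<^sup>2 - tri n"
    using subset_sum_initial by blast
  have sub: "{1..t - 1} \<subseteq> {1..n}" "{t<..n} \<union> D \<subseteq> {1..n}" "D \<subseteq> {1..n}"
    using t D(1) by fastforce+
  have "{t<..n} \<inter> D = {}" using D(1) by fastforce
  then have s: "sum f ({t<..n} \<union> D) = sum f {t<..n} + sum f D" for f :: "nat \<Rightarrow> nat"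
    using finite_subset[OF sub(3)] by (simp add: sum.union_disjoint)
  have split: "sum f {1..t} + sum f {t<..n} = sum f {1..n}" for f :: "nat \<Rightarrow> nat"
    using t by (subst sum.union_disjoint[symmetric]) (auto intro: arg_cong[where f = "sum f"])
  have "merges n 1 (t - 1) t (tri n) D"
    unfolding merges_def
  proof (intro conjI exI[of _ "[weigh {1..t - 1} ({t<..n} \<union> D)]"] allI impI)
    show "tri (t - 1) + tri t = \<Sum>D + tri n" using D(2) tt big by simp
    fix w assume w: "w permutes {1..n} \<and> consistent [weigh {1..t - 1} ({t<..n} \<union> D)] w"
    have "\<Sum>{1..t - 1} = \<Sum>({t<..n} \<union> D)"
      using D(2) tt big s[of "\<lambda>x. x"] split[of "\<lambda>x. x"] by (simp add: tri_def)
    then have "sum w {1..t - 1} = sum w {t<..n} + sum w D"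
      using consistent_weigh(1)[OF _ sub(1,2)] w s by simp
    moreover have "sum w {1..n} = tri n" using w sum.permute[of w "{1..n}" "\<lambda>x. x"] by (simp add: tri_def comp_def)
    ultimately show "sum w {1..t - 1} + sum w {1..t} = sum w D + tri n" using split[of w] by simp
  qed (use sub is_weighing_weigh in auto)
  then show ?thesis by blast
qed

section \<open>Identifying a coin\<close>

text \<open>
  Weighing three sets against the parts of a partition of \<open>{1..n}\<close> bounds their total by \<open>tri n\<close>. One part may
  be heavier than its set by \<open>e = 1\<close>: the outcome then is a strict inequality between integers, so that
  the unit is not lost.
\<close>

lemma bound_three_sets:
  assumes "5 \<le> n" "A \<subseteq> {1..n}" "B \<subseteq> {1..n}" "C \<subseteq> {1..n}" "e \<le> 1"
    "\<Sum>A + e + \<Sum>B + \<Sum>C = tri n" "\<not> clash (\<Sum>A + e) (\<Sum>B) (\<Sum>C)"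
  shows "\<exists>Ws. length Ws = 3 \<and> (\<forall>W\<in>set Ws. is_weighing n W) \<and>
    (\<forall>w. w permutes {1..n} \<and> consistent Ws w \<longrightarrow> sum w A + sum w B + sum w C + e \<le> tri n)"
proof -
  obtain X Y Z where P: "X \<union> Y \<union> Z = {1..n}" "X \<inter> Y = {}" "X \<inter> Z = {}" "Y \<inter> Z = {}"
     "\<Sum>X = \<Sum>A + e" "\<Sum>Y = \<Sum>B" "\<Sum>Z = \<Sum>C" using partition_three_sums[OF assms(1,6,7)] .
  have sub: "X \<subseteq> {1..n}" "Y \<subseteq> {1..n}" "Z \<subseteq> {1..n}" using P(1) by blast+
  show ?thesis
  proof (intro conjI exI[of _ "[weigh A X, weigh B Y, weigh C Z]"] allI impI)
    fix w assume w: "w permutes {1..n} \<and> consistent [weigh A X, weigh B Y, weigh C Z] w"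
    then have c: "consistent [weigh A X] w" "consistent [weigh B Y] w" "consistent [weigh C Z] w"
      by (auto simp: consistent_def)
    have "sum w A + e \<le> sum w X"
    proof (cases "e = 0")
      case True then show ?thesis using consistent_weigh(1)[OF c(1) assms(2) sub(1)] P(5) by simp
    next
      case False then show ?thesis using consistent_weigh(2)[OF c(1) assms(2) sub(1)] P(5) assms(5) by simp
    qed
    moreover have "sum w B = sum w Y" "sum w C = sum w Z"
      using consistent_weigh(1)[OF c(2) assms(3) sub(2)] consistent_weigh(1)[OF c(3) assms(4) sub(3)] P(6,7) by simp_all
    moreover have "sum w X + sum w Y + sum w Z = sum w (X \<union> Y \<union> Z)"
    proof -
      have "finite X" "finite Y" "finite Z" using sub finite_subset by blast+
      moreover have "(X \<union> Y) \<inter> Z = {}" using P(3,4) by blast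
      ultimately show ?thesis using P(2) by (simp add: sum.union_disjoint)
    qed
    then have "sum w X + sum w Y + sum w Z = tri n"
      using w sum.permute[of w "{1..n}" "\<lambda>x. x"] unfolding P(1) by (simp add: tri_def comp_def)
    ultimately show "sum w A + sum w B + sum w C + e \<le> tri n" by linarith
  qed (use assms sub is_weighing_weigh in auto)
qed

text \<open>
  The weighings bound the total of the six prefixes by the total of their triangular numbers, and no prefix
  can weigh less than its triangular number. Hence the prefixes \<open>{1..t - 1}\<close> and \<open>{1..t}\<close> have their true
  weights, and so has the coin \<open>t\<close>.
\<close>

lemma identifies_of_merges:
  assumes "5 \<le> n" "1 \<le> t"
    and A: "merges n i (t - 1) t c A" and B: "merges n j z x 0 B" and C: "merges n k u y 0 C"
    and sum: "t\<^sup>2 + e + (tri z + tri x) + (tri u + tri y) = tri n + c" "e \<le> 1"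
    and "\<not> clash (t\<^sup>2 - c + e) (tri z + tri x) (tri u + tri y)"
    and len: "i + j + k \<le> 4"
  shows "\<exists>Ws. length Ws \<le> 7 \<and> (\<forall>W\<in>set Ws. is_weighing n W) \<and> identifies n Ws t"
proof -
  have tt: "tri (t - 1) + tri t = t\<^sup>2" using tri_pred_add assms(2) by simp
  obtain Us where U: "A \<subseteq> {1..n}" "t\<^sup>2 = \<Sum>A + c" "length Us \<le> i" "\<forall>W\<in>set Us. is_weighing n W"
    "\<And>w. w permutes {1..n} \<Longrightarrow> consistent Us w \<Longrightarrow> sum w {1..t-1} + sum w {1..t} = sum w A + c"
    using A unfolding merges_def tt by blast
  obtain Vs where V: "B \<subseteq> {1..n}" "tri z + tri x = \<Sum>B" "length Vs \<le> j" "\<forall>W\<in>set Vs. is_weighing n W"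
    "\<And>w. w permutes {1..n} \<Longrightarrow> consistent Vs w \<Longrightarrow> sum w {1..z} + sum w {1..x} = sum w B"
    using B unfolding merges_def by auto
  obtain Ws where W: "C \<subseteq> {1..n}" "tri u + tri y = \<Sum>C" "length Ws \<le> k" "\<forall>W\<in>set Ws. is_weighing n W"
    "\<And>w. w permutes {1..n} \<Longrightarrow> consistent Ws w \<Longrightarrow> sum w {1..u} + sum w {1..y} = sum w C"
    using C unfolding merges_def by auto
  have "t\<^sup>2 - c = \<Sum>A" using U(2) by simp
  then obtain Hs where H: "length Hs = 3" "\<forall>W\<in>set Hs. is_weighing n W"
    "\<And>w. w permutes {1..n} \<Longrightarrow> consistent Hs w \<Longrightarrow> sum w A + sum w B + sum w C + e \<le> tri n"
    using bound_three_sets[of n A B C e] assms(1,7,8) sum U(1,2) V(1,2) W(1,2) by auto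
  have "w t = t" if w: "w permutes {1..n}" "consistent (Us @ Vs @ Ws @ Hs) w" for w
  proof -
    have "sum w {1..t-1} + sum w {1..t} + (sum w {1..z} + sum w {1..x}) + (sum w {1..u} + sum w {1..y})
        \<le> tri (t - 1) + tri t + (tri z + tri x) + (tri u + tri y)"
      using U(5)[OF w(1)] V(5)[OF w(1)] W(5)[OF w(1)] H(3)[OF w(1)] w(2) sum(1) tt by simp
    then have "sum w {1..t-1} = tri (t - 1)" "sum w {1..t} = tri t"
      using tri_le_sum_prefix[OF w(1)] by (smt (verit) add_mono le_antisym add_le_cancel_left add_le_cancel_right)+
    then show ?thesis using assms(2) by (cases t) auto
  qed
  then have "identifies n (Us @ Vs @ Ws @ Hs) t" by (auto simp: identifies_def consistent_def)
  moreover have "length (Us @ Vs @ Ws @ Hs) \<le> 7" using U(3) V(3) W(3) H(1) len by simp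
  moreover have "\<forall>W\<in>set (Us @ Vs @ Ws @ Hs). is_weighing n W" using U(4) V(4) W(4) H(2) by auto
  ultimately show ?thesis by blast
qed

text \<open>
  The outcomes make \<open>w\<close> strictly increasing on \<open>{1..n}\<close>, and the identity is the only such permutation.
\<close>

lemma identifies_by_neighbours:
  assumes "t \<in> {1..n}"
  shows "identifies n (map (\<lambda>i. ({i}, {Suc i})) [1..<n]) t"
  unfolding identifies_def
proof (intro allI impI)
  fix w assume w: "w permutes {1..n}"
    and "\<forall>W\<in>set (map (\<lambda>i. ({i}, {Suc i})) [1..<n]). outcome_of w W = outcome_of id W"
  then have lt: "w i < w (Suc i)" if "1 \<le> i" "i < n" for i
    using that by (auto simp: outcome_of_def Let_def split: if_splits)
  have gap: "w i + (j - i) \<le> w j" if "i \<le> j" "1 \<le> i" "j \<le> n" for i j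
    using that
  proof (induction j rule: dec_induct)
    case (step j)
    then show ?case using lt[of j] by simp
  qed simp
  have "w 1 \<in> {1..n}" "w n \<in> {1..n}" using assms w by (simp_all add: permutes_in_image del: atLeastAtMost_iff, auto)
  then show "w t = t" using gap[of 1 t] gap[of t n] assms by auto
qed

text \<open>
  No sum of two triangular numbers is \<open>2\<close> except \<open>1 + 1\<close>. If \<open>a = 1\<close> and one of the pairs has sum \<open>1\<close>, then the
  order of the indices leaves at most \<open>3\<close> units besides \<open>tri x\<close>, against \<open>tri_gap\<close>.
\<close>

lemma not_clash_triangular:
  assumes n: "9 \<le> n" and o: "y \<le> x" "z \<le> y" "u \<le> z"
    and sum: "a + (tri z + tri x) + (tri u + tri y) = tri n"
    and ne: "\<not> (z = 1 \<and> x = 1)" "\<not> (u = 1 \<and> y = 1)"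
    and two: "tri z + tri x + (tri u + tri y) \<noteq> 2"
  shows "\<not> clash a (tri z + tri x) (tri u + tri y)"
proof -
  have m: "tri y \<le> tri x" "tri z \<le> tri y" "tri u \<le> tri z" using o by (auto intro: tri_mono)
  have not2: "tri i + tri j \<noteq> 2" if "\<not> (i = 1 \<and> j = 1)" for i j
    using that tri_neq_2[of i] tri_neq_2[of j] tri_eq_1_iff[of i] tri_eq_1_iff[of j] by linarith
  have "tri x + 9 \<le> tri n" if "tri x < tri n" using tri_gap[OF that] n by linarith
  moreover have "45 \<le> tri n" using tri_mono[OF n] by (simp add: numeral_eq_Suc)
  ultimately show ?thesis
    unfolding clash_def using m sum two not2[OF ne(1)] not2[OF ne(2)] by auto
qed

theorem theorem8:
  fixes n t :: nat
  assumes "n \<ge> 1" and "t \<in> {1..n}"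
  shows "\<exists>Ws. length Ws \<le> 7 \<and> (\<forall>W\<in>set Ws. is_weighing n W) \<and> identifies n Ws t"
proof (cases "n \<le> 8")
  case True
  have "\<forall>W\<in>set (map (\<lambda>i. ({i}, {Suc i})) [1..<n]). is_weighing n W" by (auto simp: is_weighing_def)
  moreover have "length (map (\<lambda>i. ({i}, {Suc i})) [1..<n]) \<le> 7" using True by simp
  ultimately show ?thesis using identifies_by_neighbours[OF assms(2)] by blast
next
  case False
  then have n: "9 \<le> n" "5 \<le> n" by simp_all
  have t: "1 \<le> t" "t \<le> n" using assms(2) by auto
  have tt: "tri (t - 1) + tri t = t\<^sup>2" using tri_pred_add t by simp
  have t2: "t\<^sup>2 + n \<le> 2 * tri n" unfolding double_tri using t by (simp add: power2_eq_square mult_le_mono)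
  \<comment> \<open>\<open>c\<close> tells whether the pair \<open>t - 1, t\<close> outweighs all coins. For \<open>tri n - t\<^sup>2 = 2\<close> both remaining pairs\<close>
  \<comment> \<open>would have sum \<open>1\<close> and clash; there \<open>e = 1\<close> lowers the number to be represented from \<open>2\<close> to \<open>1\<close>.\<close>
  define c e where "c = (if tri n < t\<^sup>2 then tri n else 0)"
    and "e = (if t\<^sup>2 + 2 = tri n then 1 else 0 :: nat)"
  define N where "N = tri n + c - t\<^sup>2 - e"
  have N: "t\<^sup>2 + e + N = tri n + c" and N2: "N \<noteq> 2" and e: "e \<le> 1" "c \<le> t\<^sup>2"
    using t2 n by (auto simp: N_def c_def e_def)
  obtain x y z u where o: "y \<le> x" "z \<le> y" "u \<le> z" and xyzu: "tri x + tri y + tri z + tri u = N"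
    and ne: "x = z \<Longrightarrow> x \<noteq> 1 \<and> x \<noteq> 4" "y = u \<Longrightarrow> y \<noteq> 1 \<and> y \<noteq> 4"
    using four_triangular_numbers_spread[of N] by metis
  have m: "tri z \<le> tri x" "tri u \<le> tri y" "tri y \<le> tri x" "tri u \<le> tri z" using o by (auto intro: tri_mono)
  have Nn: "N \<le> tri n" using N by (auto simp: c_def split: if_splits)
  have nc: "\<not> clash (t\<^sup>2 - c + e) (tri z + tri x) (tri u + tri y)"
  proof (rule not_clash_triangular[OF n(1) o])
    show "t\<^sup>2 - c + e + (tri z + tri x) + (tri u + tri y) = tri n" using N e(2) xyzu by linarith
    show "tri z + tri x + (tri u + tri y) \<noteq> 2" using N2 xyzu by linarith
  qed (use ne in auto)
  have total: "t\<^sup>2 + e + (tri z + tri x) + (tri u + tri y) = tri n + c" using N xyzu by simp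
  have main: ?thesis if "merges n i (t - 1) t c A" "merges n j z x 0 B" "i + j \<le> 3" for i j A B
  proof -
    obtain C where "merges n 1 u y 0 C"
      using merges_one_weighing[OF n(1), of u y] o m Nn xyzu ne(2) by auto
    from identifies_of_merges[OF n(2) t(1) that(1,2) this total e(1) nc] show ?thesis
      using that(3) by simp
  qed
  have two: "\<exists>B. merges n 2 z x 0 B"
    using merges_two_weighings[OF n(2), of z x] xyzu Nn ne(1) by auto
  \<comment> \<open>The pair \<open>u, y\<close> is never heavier than \<open>z, x\<close> and takes one weighing. Two weighings go to \<open>z, x\<close>, unless\<close>
  \<comment> \<open>\<open>t\<^sup>2\<close> lies between half of \<open>tri n\<close> and \<open>tri n\<close>; then the pair \<open>t - 1, t\<close> needs them and \<open>z, x\<close> is light.\<close>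
  consider "tri n < t\<^sup>2" | "t\<^sup>2 \<le> tri n" "2 * t\<^sup>2 \<le> tri n" | "t\<^sup>2 \<le> tri n" "tri n < 2 * t\<^sup>2" by linarith
  then show ?thesis
  proof cases
    case 1
    then have "\<exists>A. merges n 1 (t - 1) t c A" using merges_overflow[OF t] by (simp add: c_def)
    with two show ?thesis using main[of 1 _ 2] by auto
  next
    case 2
    then have "\<exists>A. merges n 1 (t - 1) t c A"
      using merges_one_weighing[OF n(1), of "t - 1" t] tt t by (auto simp: c_def)
    with two show ?thesis using main[of 1 _ 2] by auto
  next
    case 3
    have "\<not> (t - 1 = 1 \<and> t = 1)" by linarith
    with 3 have "\<exists>A. merges n 2 (t - 1) t c A"
      using merges_two_weighings[OF n(2), of "t - 1" t] tt by (simp add: c_def)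
    moreover have "\<exists>B. merges n 1 z x 0 B"
      using merges_one_weighing[OF n(1), of z x] 3 N xyzu o ne(1) by (auto simp: c_def)
    ultimately show ?thesis using main[of 2 _ 1] by auto
  qed
qed

end
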